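(* Let $\mathfrak{K_V}=(A,B(x),\mathbb X(x);\sigma_1,\sigma_2,\gamma,\gamma_*(x);\mathcal H,\mathbb C^2;\mathrm I)$ be a Sturm-Liouville vessel, let $q(x)=2\beta'(x)$ be its potential and fix an arbitrary $x_0\in\mathrm I$. Define $$\Omega(x,y)=\begin{bmatrix}1&0\end{bmatrix}B^*(x)\mathbb X^{-1}(x_0)B(y)\begin{bmatrix}1\\0\end{bmatrix},\qquad K(x,y)=-\begin{bmatrix}1&0\end{bmatrix}B^*(x)\mathbb X^{-1}(x)B(y)\begin{bmatrix}1\\0\end{bmatrix}.$$ Then the Gelfand-Levitan equation $$K(x,y)+\Omega(x,y)+\int_{x_0}^xK(x,t)\Omega(t,y)\,dt=0$$ holds, and $q(x)=2\dfrac{d}{dx}K(x,x)$.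
   Context: Sturm-Liouville (SL) vessel parameters on $\mathcal E=\mathbb C^2$: $$\sigma_1=\begin{bmatrix}0&1\\1&0\end{bmatrix},\ \sigma_2=\begin{bmatrix}1&0\\0&0\end{bmatrix},\ \gamma=\begin{bmatrix}0&0\\0&i\end{bmatrix},\ \gamma_*(x)=\begin{bmatrix}-i(\beta'(x)-\beta^2(x))&-\beta(x)\\ \beta(x)&i\end{bmatrix},$$ where $\beta$ is a real valued differentiable function on an interval $\mathrm I$. An SL vessel on $\mathrm I$ is a collection $(A,B(x),\mathbb X(x);\sigma_1,\sigma_2,\gamma,\gamma_*(x);\mathcal H,\mathbb C^2;\mathrm I)$ with these parameters, where $\mathcal H$ is a Hilbert space, $A,\mathbb X(x):\mathcal H\to\mathcal H$ ($A$ possibly unbounded with domain $D(A)$) and $B(x):\mathbb C^2\to\mathcal H$ satisfy the regularity assumptions: there is a point $x_1\in\mathrm I$ with $B(x_1)\mathbb C^2\subseteq D(A^n)$ and $\|A^nB(x_1)\|\le(C\sqrt n)^n$ for all $n\ge1$ and some $C>0$; $\mathbb X(x)$ is self-adjoint and invertible for all $x\in\mathrm I$; and the vessel conditions $$0=\tfrac{d}{dx}(B(x)\sigma_1)+AB(x)\sigma_2+B(x)\gamma,\quad A\mathbb X(x)+\mathbb X(x)A^*+B(x)\sigma_1B^*(x)=0,\quad \tfrac{d}{dx}\mathbb X(x)=B(x)\sigma_2B^*(x),$$ $$\gamma_*(x)=\gamma+\sigma_2B^*(x)\mathbb X^{-1}(x)B(x)\sigma_1-\sigma_1B^*(x)\mathbb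 X^{-1}(x)B(x)\sigma_2.$$ *)

theory Defs
  imports "HOL-Analysis.Analysis"
begin

section \<open>Complex Hilbert spaces\<close>

text \<open>HOL-Analysis only provides real inner product spaces. The class below adds a complex
  structure to one, with real part of the Hermitian form equal to the given real inner product
  (so norm and topology are the usual ones). The form is conjugate-linear in its first argument.\<close>

class complex_inner = real_inner +
  fixes scaleC :: "complex \<Rightarrow> 'a \<Rightarrow> 'a" (infixr "*\<^sub>C" 75)
    and cinner :: "'a \<Rightarrow> 'a \<Rightarrow> complex"
  assumes scaleC_add_right: "a *\<^sub>C (x + y) = a *\<^sub>C x + a *\<^sub>C y"
    and scaleC_add_left: "(a + b) *\<^sub>C x = a *\<^sub>C x + b *\<^sub>C x"
    and scaleC_scaleC: "a *\<^sub>C (b *\<^sub>C x) = (a * b) *\<^sub>C x"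
    and scaleC_of_real: "complex_of_real r *\<^sub>C x = r *\<^sub>R x"
    and cinner_commute: "cinner x y = cnj (cinner y x)"
    and cinner_add_left: "cinner (x + y) z = cinner x z + cinner y z"
    and cinner_scaleC_left: "cinner (a *\<^sub>C x) y = cnj a * cinner x y"
    and Re_cinner: "Re (cinner x y) = inner x y"

class chilbert_space = complex_inner + complete_space

instantiation complex :: complex_inner
begin

definition scaleC_complex :: "complex \<Rightarrow> complex \<Rightarrow> complex"
  where "scaleC_complex a x = a * x"

definition cinner_complex :: "complex \<Rightarrow> complex \<Rightarrow> complex"
  where "cinner_complex x y = cnj x * y"

instance
  by standard
    (auto simp: scaleC_complex_def cinner_complex_def algebra_simps scaleR_conv_of_real
      inner_complex_def)

end

instantiation vec :: (complex_inner, finite) complex_inner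
begin

definition scaleC_vec :: "complex \<Rightarrow> 'a ^ 'b \<Rightarrow> 'a ^ 'b"
  where "scaleC_vec a x = (\<chi> i. a *\<^sub>C (x $ i))"

definition cinner_vec :: "'a ^ 'b \<Rightarrow> 'a ^ 'b \<Rightarrow> complex"
  where "cinner_vec x y = (\<Sum>i\<in>UNIV. cinner (x $ i) (y $ i))"

instance
proof
  fix a b :: complex and r :: real and x y z :: "'a ^ 'b"
  show "a *\<^sub>C (x + y) = a *\<^sub>C x + a *\<^sub>C y"
    by (simp add: vec_eq_iff scaleC_vec_def scaleC_add_right)
  show "(a + b) *\<^sub>C x = a *\<^sub>C x + b *\<^sub>C x"
    by (simp add: vec_eq_iff scaleC_vec_def scaleC_add_left)
  show "a *\<^sub>C (b *\<^sub>C x) = (a * b) *\<^sub>C x"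
    by (simp add: vec_eq_iff scaleC_vec_def scaleC_scaleC)
  show "complex_of_real r *\<^sub>C x = r *\<^sub>R x"
    by (simp add: vec_eq_iff scaleC_vec_def scaleC_of_real)
  show "cinner x y = cnj (cinner y x)"
    unfolding cinner_vec_def cnj_sum by (intro sum.cong refl cinner_commute)
  show "cinner (x + y) z = cinner x z + cinner y z"
    by (simp add: cinner_vec_def cinner_add_left sum.distrib)
  show "cinner (a *\<^sub>C x) y = cnj a * cinner x y"
    by (simp add: cinner_vec_def scaleC_vec_def cinner_scaleC_left sum_distrib_left)
  show "Re (cinner x y) = inner x y"
    by (simp add: cinner_vec_def inner_vec_def Re_cinner)
qed

end

definition csubspace :: "'a::complex_inner set \<Rightarrow> bool"
  where "csubspace S \<longleftrightarrow>
    0 \<in> S \<and> (\<forall>x\<in>S. \<forall>y\<in>S. x + y \<in> S) \<and> (\<forall>c. \<forall>x\<in>S. c *\<^sub>C x \<in> S)"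

definition clinear_on :: "'a::complex_inner set \<Rightarrow> ('a \<Rightarrow> 'b::complex_inner) \<Rightarrow> bool"
  where "clinear_on S f \<longleftrightarrow>
    (\<forall>x\<in>S. \<forall>y\<in>S. f (x + y) = f x + f y) \<and> (\<forall>c. \<forall>x\<in>S. f (c *\<^sub>C x) = c *\<^sub>C f x)"

definition bounded_clinear :: "('a::complex_inner \<Rightarrow> 'b::complex_inner) \<Rightarrow> bool"
  where "bounded_clinear f \<longleftrightarrow> bounded_linear f \<and> clinear_on UNIV f"

text \<open>Adjoint of an everywhere defined bounded operator, in the style of \<^const>\<open>adjoint\<close>.\<close>

definition cadjoint :: "('a::complex_inner \<Rightarrow> 'b::complex_inner) \<Rightarrow> 'b \<Rightarrow> 'a"
  where "cadjoint f = (SOME g. \<forall>x y. cinner (f x) y = cinner x (g y))"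

definition selfadjoint :: "('a::complex_inner \<Rightarrow> 'a) \<Rightarrow> bool"
  where "selfadjoint f \<longleftrightarrow> bounded_clinear f \<and> (\<forall>x y. cinner (f x) y = cinner x (f y))"


section \<open>Unbounded operators\<close>

text \<open>An unbounded operator is a domain \<open>D\<close> together with a function \<open>A\<close> whose values
  outside \<open>D\<close> are irrelevant. Density of the domain is what makes the adjoint single-valued.\<close>

definition densely_defined_op :: "'a::complex_inner set \<Rightarrow> ('a \<Rightarrow> 'a) \<Rightarrow> bool"
  where "densely_defined_op D A \<longleftrightarrow> csubspace D \<and> closure D = UNIV \<and> clinear_on D A"

definition adj_dom :: "'a::complex_inner set \<Rightarrow> ('a \<Rightarrow> 'a) \<Rightarrow> 'a set"
  where "adj_dom D A = {y. \<exists>z. \<forall>u\<in>D. cinner (A u) y = cinner u z}"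

definition adj_op :: "'a::complex_inner set \<Rightarrow> ('a \<Rightarrow> 'a) \<Rightarrow> 'a \<Rightarrow> 'a"
  where "adj_op D A y = (THE z. \<forall>u\<in>D. cinner (A u) y = cinner u z)"

fun pow_dom :: "'a set \<Rightarrow> ('a \<Rightarrow> 'a) \<Rightarrow> nat \<Rightarrow> 'a set"
  where
    "pow_dom D A 0 = UNIV"
  | "pow_dom D A (Suc n) = {u \<in> D. A u \<in> pow_dom D A n}"


section \<open>Sturm-Liouville vessels\<close>

definition sl_sigma1 :: "complex ^ 2 ^ 2"
  where "sl_sigma1 = vector [vector [0, 1], vector [1, 0]]"

definition sl_sigma2 :: "complex ^ 2 ^ 2"
  where "sl_sigma2 = vector [vector [1, 0], vector [0, 0]]"

definition sl_gamma :: "complex ^ 2 ^ 2"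
  where "sl_gamma = vector [vector [0, 0], vector [0, \<i>]]"

text \<open>Derivatives are taken within the interval, hence one-sided at end points it contains.\<close>

definition sl_gamma_star :: "real set \<Rightarrow> (real \<Rightarrow> real) \<Rightarrow> real \<Rightarrow> complex ^ 2 ^ 2"
  where "sl_gamma_star I \<beta> x =
    vector [vector [- \<i> * of_real (vector_derivative \<beta> (at x within I) - (\<beta> x)\<^sup>2), - of_real (\<beta> x)],
            vector [of_real (\<beta> x), \<i>]]"

text \<open>The operator identities are stated on vectors. For \<open>B\<close> this is the same as in operator
  norm, its domain being finite-dimensional; for \<open>X\<close> the strong derivative is
  norm-continuous, so it is a derivative in operator norm as well. The Lyapunov equation
  is an identity on the domain of the adjoint of \<open>A\<close>. The inverse of the
  bijection \<open>X x\<close> is automatically bounded.\<close>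

locale sl_vessel =
  fixes I :: "real set"
    and \<beta> :: "real \<Rightarrow> real"
    and D :: "'h::chilbert_space set"
    and A :: "'h \<Rightarrow> 'h"
    and B :: "real \<Rightarrow> complex ^ 2 \<Rightarrow> 'h"
    and X :: "real \<Rightarrow> 'h \<Rightarrow> 'h"
  assumes interval: "is_interval I" "\<exists>a\<in>I. \<exists>b\<in>I. a < b"
    and beta_differentiable: "\<beta> differentiable_on I"
    and A_op: "densely_defined_op D A"
    and B_op: "\<And>x. x \<in> I \<Longrightarrow> bounded_clinear (B x)"
    and regular: "\<exists>x1\<in>I. (\<forall>n\<ge>1. range (B x1) \<subseteq> pow_dom D A n) \<and>
      (\<exists>C>0. \<forall>n\<ge>1. onorm (\<lambda>v. (A ^^ n) (B x1 v)) \<le> (C * sqrt (real n)) ^ n)"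
    and X_selfadjoint: "\<And>x. x \<in> I \<Longrightarrow> selfadjoint (X x)"
    and X_invertible: "\<And>x. x \<in> I \<Longrightarrow> bij (X x)"
    and B_domain: "\<And>x v. x \<in> I \<Longrightarrow> B x (sl_sigma2 *v v) \<in> D"
    and B_equation: "\<And>x v. x \<in> I \<Longrightarrow>
      ((\<lambda>s. B s (sl_sigma1 *v v)) has_vector_derivative
        - (A (B x (sl_sigma2 *v v)) + B x (sl_gamma *v v))) (at x within I)"
    and X_domain: "\<And>x h. x \<in> I \<Longrightarrow> h \<in> adj_dom D A \<Longrightarrow> X x h \<in> D"
    and Lyapunov: "\<And>x h. x \<in> I \<Longrightarrow> h \<in> adj_dom D A \<Longrightarrow>
      A (X x h) + X x (adj_op D A h) + B x (sl_sigma1 *v cadjoint (B x) h) = 0"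
    and X_equation: "\<And>x h. x \<in> I \<Longrightarrow>
      ((\<lambda>s. X s h) has_vector_derivative B x (sl_sigma2 *v cadjoint (B x) h)) (at x within I)"
    and linkage: "\<And>x v. x \<in> I \<Longrightarrow>
      sl_gamma_star I \<beta> x *v v = sl_gamma *v v
        + sl_sigma2 *v cadjoint (B x) (inv (X x) (B x (sl_sigma1 *v v)))
        - sl_sigma1 *v cadjoint (B x) (inv (X x) (B x (sl_sigma2 *v v)))"

definition sl_potential :: "real set \<Rightarrow> (real \<Rightarrow> real) \<Rightarrow> real \<Rightarrow> real"
  where "sl_potential I \<beta> x = 2 * vector_derivative \<beta> (at x within I)"


section \<open>Gelfand-Levitan kernels\<close>

definition gl_Omega ::
    "(real \<Rightarrow> complex ^ 2 \<Rightarrow> 'h::chilbert_space) \<Rightarrow> (real \<Rightarrow> 'h \<Rightarrow> 'h) \<Rightarrow>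
      real \<Rightarrow> real \<Rightarrow> real \<Rightarrow> complex"
  where "gl_Omega B X x0 x y =
    cadjoint (B x) (inv (X x0) (B y (vector [1, 0]))) $ 1"

definition gl_K ::
    "(real \<Rightarrow> complex ^ 2 \<Rightarrow> 'h::chilbert_space) \<Rightarrow> (real \<Rightarrow> 'h \<Rightarrow> 'h) \<Rightarrow>
      real \<Rightarrow> real \<Rightarrow> complex"
  where "gl_K B X x y =
    - (cadjoint (B x) (inv (X x) (B y (vector [1, 0]))) $ 1)"

end

theory Submission
  imports Defs
begin

text \<open>
  Write \<open>b t = B t e\<^sub>1\<close>.  The only entries of \<open>B\<^sup>* X\<^sup>-\<^sup>1 B\<close> in the two kernels are
  \<open>\<Omega>(x,y) = \<langle>b x, X(x\<^sub>0)\<^sup>-\<^sup>1 b y\<rangle>\<close> and \<open>K(x,y) = -\<langle>b x, X(x)\<^sup>-\<^sup>1 b y\<rangle>\<close>, and since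
  \<open>\<sigma>\<^sub>2\<close> is the projection on \<open>e\<^sub>1\<close>, the equation for \<open>X\<close> says \<open>X'(t) h = \<langle>b t, h\<rangle> b t\<close>.

  The Gelfand-Levitan equation is the resolvent identity
  \<open>X(x\<^sub>0)\<^sup>-\<^sup>1 - X(x)\<^sup>-\<^sup>1 = X(x)\<^sup>-\<^sup>1 (X(x) - X(x\<^sub>0)) X(x\<^sub>0)\<^sup>-\<^sup>1\<close>, applied to \<open>b y\<close> and paired
  with \<open>b x\<close>: the middle factor is the integral of the rank one operators
  \<open>X'(t)\<close>, and by self-adjointness of \<open>X(x)\<^sup>-\<^sup>1\<close> the integrand splits into
  \<open>\<langle>b x, X(x)\<^sup>-\<^sup>1 b t\<rangle> \<langle>b t, X(x\<^sub>0)\<^sup>-\<^sup>1 b y\<rangle> = -K(x,t) \<Omega>(t,y)\<close>.  To apply the fundamental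
  theorem of calculus one needs \<open>b\<close> continuous, and the second column of the equation for \<open>B\<close>
  even makes it differentiable (lemmas \<open>column1_continuous\<close>, \<open>X_deriv\<close>, \<open>gelfand_levitan\<close>).

  The formula for the potential is the derivative of \<open>\<beta>(x) = K(x,x)\<close>, which is the lower left
  entry of the linkage condition (lemma \<open>gl_K_diagonal\<close>).
\<close>

section \<open>The Hermitian form and adjoints\<close>

lemma cinner_scaleC_right: "cinner x (a *\<^sub>C y) = a * cinner x y"
  by (metis cinner_scaleC_left cinner_commute complex_cnj_cnj complex_cnj_mult)

lemma cinner_zero_left: "cinner 0 x = 0"
  by (metis add_cancel_right_left cinner_add_left)

text \<open>Conjugate-linearity in the first argument recovers the imaginary part from the real inner
  product, so that continuity of the form is inherited from that of \<^const>\<open>inner\<close>.\<close>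

lemma cinner_eq_Complex: "cinner x y = Complex (inner x y) (inner (\<i> *\<^sub>C x) y)"
  by (simp add: complex_eq_iff cinner_scaleC_left flip: Re_cinner)

lemma bounded_linear_cinner_right: "bounded_linear (cinner x)"
proof -
  have "bounded_linear (\<lambda>y. of_real (inner x y) + \<i> * of_real (inner (\<i> *\<^sub>C x) y))"
    by (intro bounded_linear_add bounded_linear_const_mult bounded_linear_of_real
        bounded_linear_compose[OF bounded_linear_of_real] bounded_linear_inner_right)
  then show ?thesis
    by (simp add: cinner_eq_Complex[abs_def] Complex_eq)
qed

lemma clinear_sum:
  assumes "clinear_on UNIV f"
  shows "f (\<Sum>i\<in>S. a i *\<^sub>C v i) = (\<Sum>i\<in>S. a i *\<^sub>C f (v i))"
proof -
  have add: "f (x + y) = f x + f y" and scale: "f (c *\<^sub>C x) = c *\<^sub>C f x" for c x y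
    using assms by (auto simp: clinear_on_def)
  have "f 0 = 0"
    using add[of 0 0] by simp
  then show ?thesis
    by (induction S rule: infinite_finite_induct) (auto simp: add scale)
qed

lemma cinner_sum_left: "cinner (\<Sum>i\<in>S. f i) y = (\<Sum>i\<in>S. cinner (f i) y)"
  by (induction S rule: infinite_finite_induct) (auto simp: cinner_add_left cinner_zero_left)

lemma cinner_axis: "cinner (axis i 1) (w :: complex ^ 'n) = w $ i"
proof -
  have "cinner (axis i 1 $ j) (w $ j) = (if j = i then w $ j else 0)" for j
    by (simp add: axis_def cinner_complex_def)
  then show ?thesis
    by (simp add: cinner_vec_def)
qed

text \<open>The right-hand sides are the coordinates of a vector with the defining property of the
  adjoint, so the choice in \<^const>\<open>cadjoint\<close> has a witness; pairing with the unit vectors then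
  determines it.\<close>

lemma cadjoint_nth:
  fixes f :: "complex ^ 'n \<Rightarrow> 'h::complex_inner"
  assumes "clinear_on UNIV f"
  shows "cadjoint f h $ i = cinner (f (axis i 1)) h"
proof -
  have expand: "v = (\<Sum>j\<in>UNIV. v $ j *\<^sub>C axis j 1)" for v :: "complex ^ 'n"
    by (simp add: vec_eq_iff scaleC_vec_def scaleC_complex_def axis_def if_distrib cong: if_cong)
  define g where "g h = (\<chi> j. cinner (f (axis j 1)) h)" for h
  have "cinner (f v) h = cinner v (g h)" for v h
  proof -
    have "cinner (f v) h = cinner (\<Sum>j\<in>UNIV. v $ j *\<^sub>C f (axis j 1)) h"
      by (subst expand) (simp only: clinear_sum[OF assms])
    also have "\<dots> = cinner v (g h)"
      by (simp add: cinner_sum_left cinner_scaleC_left cinner_vec_def g_def cinner_complex_def)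
    finally show ?thesis .
  qed
  then have "\<forall>x y. cinner (f x) y = cinner x (cadjoint f y)"
    unfolding cadjoint_def
    using someI[of "\<lambda>g. \<forall>x y. cinner (f x) y = cinner x (g y)" g] by blast
  then show ?thesis
    by (simp add: cinner_axis)
qed

lemma selfadjoint_inv:
  assumes "selfadjoint f" "bij f"
  shows "cinner (inv f x) y = cinner x (inv f y)"
proof -
  have "cinner (f (inv f x)) (inv f y) = cinner (inv f x) (f (inv f y))"
    using assms(1) by (simp add: selfadjoint_def)
  then show ?thesis
    using assms(2) by (simp add: bij_is_surj surj_f_inv_f)
qed


section \<open>Columns of the vessel operators\<close>

lemma vector_axis: "vector [1, 0] = (axis 1 1 :: complex ^ 2)"
  by (simp add: vec_eq_iff forall_2 axis_def)

lemma sl_sigma1_mult: "sl_sigma1 *v v = vector [v $ 2, v $ 1]"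
  by (simp add: vec_eq_iff forall_2 sl_sigma1_def matrix_vector_mult_def sum_2)

lemma sl_sigma2_mult: "sl_sigma2 *v v = v $ 1 *\<^sub>C axis 1 1"
  by (simp add: vec_eq_iff forall_2 sl_sigma2_def matrix_vector_mult_def sum_2 axis_def
      scaleC_vec_def scaleC_complex_def)

context sl_vessel
begin

lemma B_clinear: "x \<in> I \<Longrightarrow> clinear_on UNIV (B x)"
  using B_op by (simp add: bounded_clinear_def)

lemma gl_Omega_eq:
  "x \<in> I \<Longrightarrow> gl_Omega B X x0 x y = cinner (B x (axis 1 1)) (inv (X x0) (B y (axis 1 1)))"
  by (simp add: gl_Omega_def vector_axis cadjoint_nth[OF B_clinear])

lemma gl_K_eq:
  "x \<in> I \<Longrightarrow> gl_K B X x y = - cinner (B x (axis 1 1)) (inv (X x) (B y (axis 1 1)))"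
  by (simp add: gl_K_def vector_axis cadjoint_nth[OF B_clinear])

text \<open>Applied to \<open>e\<^sub>2\<close>, the equation for \<open>B\<close> differentiates \<open>B \<sigma>\<^sub>1 e\<^sub>2 = B e\<^sub>1\<close>.\<close>

lemma column1_continuous: "continuous_on I (\<lambda>t. B t (axis 1 1))"
proof -
  have e1: "sl_sigma1 *v axis 2 1 = axis 1 1"
    by (simp add: sl_sigma1_mult vec_eq_iff forall_2 axis_def)
  show ?thesis
    using has_vector_derivative_continuous[OF B_equation[of _ "axis 2 1"]]
    by (simp add: e1 continuous_on_eq_continuous_within)
qed

lemma X_deriv:
  assumes "x \<in> I"
  shows "((\<lambda>t. X t h) has_vector_derivative
    cinner (B x (axis 1 1)) h *\<^sub>C B x (axis 1 1)) (at x within I)"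
proof -
  have "B x (c *\<^sub>C v) = c *\<^sub>C B x v" for c v
    using B_clinear[OF assms] unfolding clinear_on_def by blast
  then show ?thesis
    using X_equation[OF assms, of h]
    by (simp only: sl_sigma2_mult cadjoint_nth[OF B_clinear[OF assms]])
qed


section \<open>The Gelfand-Levitan equation\<close>

lemma gelfand_levitan:
  assumes x0: "x0 \<in> I" and x: "x \<in> I" and y: "y \<in> I"
  shows "interval_lebesgue_integrable lborel (ereal x0) (ereal x)
      (\<lambda>t. gl_K B X x t * gl_Omega B X x0 t y)"
    and "gl_K B X x y + gl_Omega B X x0 x y
      + (LBINT t=ereal x0..ereal x. gl_K B X x t * gl_Omega B X x0 t y) = 0"
proof -
  define b where "b t = B t (axis 1 1)" for t
  define g where "g = inv (X x) (b x)"
  define h where "h = inv (X x0) (b y)"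
  define J where "J = {min x0 x..max x0 x}"
  have JI: "J \<subseteq> I"
    using mem_is_interval_1_I[OF interval(1) x0 x] mem_is_interval_1_I[OF interval(1) x x0]
    unfolding J_def by (cases "x0 \<le> x") auto
  have inv_sym: "cinner (b x) (inv (X x) w) = cinner g w" for w
    unfolding g_def by (rule selfadjoint_inv[OF X_selfadjoint[OF x] X_invertible[OF x], symmetric])
  have integrand: "gl_K B X x t * gl_Omega B X x0 t y = - (cinner (b t) h * cinner g (b t))"
    if "t \<in> J" for t
    using that JI x by (auto simp: gl_K_eq gl_Omega_eq inv_sym h_def simp flip: b_def)
  have cont_right: "continuous_on J (\<lambda>t. cinner w (b t))" for w
    unfolding b_def
    using continuous_on_subset[OF column1_continuous JI]
    by (rule bounded_linear.continuous_on[OF bounded_linear_cinner_right])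
  have cont: "continuous_on J (\<lambda>t. gl_K B X x t * gl_Omega B X x0 t y)"
  proof -
    have "continuous_on J (\<lambda>t. - (cnj (cinner h (b t)) * cinner g (b t)))"
      by (intro continuous_on_minus continuous_on_mult continuous_on_cnj cont_right)
    moreover have "- (cnj (cinner h (b t)) * cinner g (b t)) = gl_K B X x t * gl_Omega B X x0 t y"
      if "t \<in> J" for t
      by (simp only: integrand[OF that] cinner_commute[of "b t" h])
    ultimately show ?thesis
      by (rule continuous_on_eq)
  qed
  show "interval_lebesgue_integrable lborel (ereal x0) (ereal x)
      (\<lambda>t. gl_K B X x t * gl_Omega B X x0 t y)"
  proof (cases "x0 \<le> x")
    case True
    with cont show ?thesis
      by (intro interval_integrable_continuous_on) (auto simp: J_def)
  next
    case False
    with cont show ?thesis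
      by (subst interval_integrable_endpoints_reverse, intro interval_integrable_continuous_on)
        (auto simp: J_def)
  qed
  have deriv: "((\<lambda>t. - cinner g (X t h)) has_vector_derivative
      gl_K B X x t * gl_Omega B X x0 t y) (at t within J)" if "t \<in> J" for t
  proof -
    have "((\<lambda>t. X t h) has_vector_derivative cinner (b t) h *\<^sub>C b t) (at t within J)"
      using has_vector_derivative_within_subset[OF X_deriv JI] that JI by (auto simp: b_def)
    from bounded_linear.has_vector_derivative[OF bounded_linear_cinner_right this, of g]
    show ?thesis
      by (auto intro!: derivative_eq_intros simp: integrand[OF that] cinner_scaleC_right)
  qed
  have "(LBINT t=ereal x0..ereal x. gl_K B X x t * gl_Omega B X x0 t y)
      = - cinner g (X x h) - (- cinner g (X x0 h))"
    using cont deriv by (intro interval_integral_FTC_finite) (auto simp: J_def)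
  also have "\<dots> = cinner g (b y) - cinner g (X x h)"
    using X_invertible[OF x0] by (simp add: h_def bij_is_surj surj_f_inv_f)
  also have "cinner g (b y) = - gl_K B X x y"
    by (simp add: gl_K_eq[OF x] inv_sym flip: b_def)
  also have "cinner g (X x h) = gl_Omega B X x0 x y"
    using X_invertible[OF x]
    by (simp add: gl_Omega_eq[OF x] bij_is_inj flip: inv_sym b_def h_def)
  finally show "gl_K B X x y + gl_Omega B X x0 x y
      + (LBINT t=ereal x0..ereal x. gl_K B X x t * gl_Omega B X x0 t y) = 0"
    by simp
qed


section \<open>The potential\<close>

text \<open>In the lower left entry of the linkage condition the terms with \<open>\<gamma>\<close> and with \<open>\<sigma>\<^sub>2\<close> as the
  left factor vanish; what remains is \<open>-\<langle>B e\<^sub>1, X\<^sup>-\<^sup>1 B e\<^sub>1\<rangle>\<close>.\<close>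

lemma gl_K_diagonal:
  assumes "x \<in> I"
  shows "gl_K B X x x = of_real (\<beta> x)"
proof -
  let ?e = "axis 1 1 :: complex ^ 2"
  have sig: "sl_sigma2 *v ?e = ?e"
    by (simp add: sl_sigma2_mult vec_eq_iff scaleC_vec_def scaleC_complex_def axis_def)
  have "(sl_gamma_star I \<beta> x *v ?e) $ 2 = of_real (\<beta> x)"
    by (simp add: sl_gamma_star_def matrix_vector_mult_def sum_2 axis_def)
  moreover have "(sl_gamma *v ?e) $ 2 = 0"
    by (simp add: sl_gamma_def matrix_vector_mult_def sum_2 axis_def)
  moreover have "(sl_sigma2 *v w) $ 2 = 0" for w
    by (simp add: sl_sigma2_mult scaleC_vec_def scaleC_complex_def axis_def)
  moreover have "(sl_sigma1 *v cadjoint (B x) (inv (X x) (B x (sl_sigma2 *v ?e)))) $ 2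
      = - gl_K B X x x"
    by (simp add: sl_sigma1_mult sig gl_K_eq[OF assms] cadjoint_nth[OF B_clinear[OF assms]])
  ultimately show ?thesis
    using arg_cong[OF linkage[OF assms, of ?e], of "\<lambda>v. v $ 2"] by simp
qed

lemma gl_K_diagonal_deriv:
  assumes "x \<in> I"
  shows "((\<lambda>s. gl_K B X s s) has_vector_derivative
    of_real (vector_derivative \<beta> (at x within I))) (at x within I)"
proof -
  have "(\<beta> has_vector_derivative vector_derivative \<beta> (at x within I)) (at x within I)"
    using beta_differentiable assms by (simp add: differentiable_on_def vector_derivative_works)
  then have "((\<lambda>s. complex_of_real (\<beta> s)) has_vector_derivative
      of_real (vector_derivative \<beta> (at x within I))) (at x within I)"
    by (rule bounded_linear.has_vector_derivative[OF bounded_linear_of_real])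
  then show ?thesis
    by (rule has_vector_derivative_transform[OF assms gl_K_diagonal, rotated])
qed

lemma not_isolated:
  assumes "x \<in> I"
  shows "at x within I \<noteq> bot"
proof -
  have "connected I"
    using interval(1) by (rule is_interval_connected)
  moreover have "I \<noteq> {x}"
    using interval(2) by fastforce
  ultimately show ?thesis
    using connected_imp_perfect[of I x] assms
    by (auto simp: trivial_limit_within)
qed

end

theorem mainTheorem4:
  fixes I :: "real set"
    and \<beta> :: "real \<Rightarrow> real"
    and D :: "'h::chilbert_space set"
    and A :: "'h \<Rightarrow> 'h"
    and B :: "real \<Rightarrow> complex ^ 2 \<Rightarrow> 'h"
    and X :: "real \<Rightarrow> 'h \<Rightarrow> 'h"
    and x0 :: real
  assumes "sl_vessel I \<beta> D A B X"
    and "x0 \<in> I"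
  shows "(\<forall>x\<in>I. \<forall>y\<in>I.
      interval_lebesgue_integrable lborel (ereal x0) (ereal x)
        (\<lambda>t. gl_K B X x t * gl_Omega B X x0 t y) \<and>
      gl_K B X x y + gl_Omega B X x0 x y
        + (LBINT t=ereal x0..ereal x. gl_K B X x t * gl_Omega B X x0 t y) = 0) \<and>
    (\<forall>x\<in>I.
      (\<lambda>s. gl_K B X s s) differentiable (at x within I) \<and>
      complex_of_real (sl_potential I \<beta> x)
        = 2 * vector_derivative (\<lambda>s. gl_K B X s s) (at x within I))"
proof -
  interpret sl_vessel I \<beta> D A B X
    by (rule assms(1))
  have "(\<lambda>s. gl_K B X s s) differentiable (at x within I)"
    and "complex_of_real (sl_potential I \<beta> x)
      = 2 * vector_derivative (\<lambda>s. gl_K B X s s) (at x within I)" if "x \<in> I" for x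
    using gl_K_diagonal_deriv[OF that]
      vector_derivative_within[OF not_isolated[OF that] gl_K_diagonal_deriv[OF that]]
    by (auto simp: sl_potential_def intro: differentiableI_vector)
  then show ?thesis
    using gelfand_levitan[OF assms(2)] by blast
qed

end
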